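(* Let $G$ be a colored graph where all vertices share the same color and all edges share the same color. The reciprocal variety $\mathcal{L}_G^{-1}$ of the associated colored Gaussian graphical model is the affine cone over a rational normal curve. Its degree is bounded above by the number of distinct eigenvalues of the adjacency matrix of $G$.
   Context: $G$ is a (finite, simple) graph on vertex set $\{1,\ldots,n\}$ with edge set $E$; vertices and edges do not share colors, and there are exactly two colors, one (with parameter $\theta_1$) occurring on the vertices and one (with parameter $\theta_2$) occurring on the edges. The associated linear space of symmetric $n\times n$ matrices is $\mathcal{L}_G=\{K(\theta)=\theta_1\mathrm{Id}_n+\theta_2A_G\mid\theta_1,\theta_2\in\mathbb{C}\}$, where $A_G$ is the adjacency matrix of $G$. The reciprocal variety $\mathcal{L}_G^{-1}$ is the Zariski closure of the image of the rational map $$\phi_G\colon\mathbb{C}^2\dashrightarrow\mathbb{C}^{\binom{n+1}{2}},\quad(\theta_1,\theta_2)\mapsto\left((K(\theta)^{-1})_{ij}\right)_{1\le i\le j\le n}.$$ A rational normal curve of degree $e$ is a curve in a projective space that, up to a linear change of coordinates on its linear span $\mathbb{P}^e$, is the image of $\mathbb{P}^1\to\mathbb{P}^e$, $[s:t]\mapsto[s^e:s^{e-1}t:\cdots:t^e]$. Here the curve lies in $\mathbb{P}\mathbb{C}^{\binom{n+1}{2}}$. *)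

theory Defs
  imports "Jordan_Normal_Form.Spectral_Radius"
begin

section \<open>Zariski closure in a complex coordinate space\<close>

text \<open>The coordinate space with index set \<open>I\<close> is modelled by the functions that vanish outside \<open>I\<close>.\<close>

definition coord_space :: "'i set \<Rightarrow> ('i \<Rightarrow> complex) set" where
  "coord_space I = {x. \<forall>i. i \<notin> I \<longrightarrow> x i = 0}"

inductive poly_fun :: "'i set \<Rightarrow> (('i \<Rightarrow> complex) \<Rightarrow> complex) \<Rightarrow> bool" for I where
  const: "poly_fun I (\<lambda>x. c)"
| coord: "i \<in> I \<Longrightarrow> poly_fun I (\<lambda>x. x i)"
| add: "poly_fun I p \<Longrightarrow> poly_fun I q \<Longrightarrow> poly_fun I (\<lambda>x. p x + q x)"
| mult: "poly_fun I p \<Longrightarrow> poly_fun I q \<Longrightarrow> poly_fun I (\<lambda>x. p x * q x)"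

definition zariski_closure :: "'i set \<Rightarrow> ('i \<Rightarrow> complex) set \<Rightarrow> ('i \<Rightarrow> complex) set" where
  "zariski_closure I S =
     {x \<in> coord_space I. \<forall>p. poly_fun I p \<longrightarrow> (\<forall>y\<in>S. p y = 0) \<longrightarrow> p x = 0}"


section \<open>Projective curves\<close>

text \<open>A point of projective space is represented by the line through the origin that it
  stands for, as a set of vectors (including the origin). A projective set is a set of such lines.\<close>

definition proj_point :: "('i \<Rightarrow> complex) \<Rightarrow> ('i \<Rightarrow> complex) set" where
  "proj_point v = {\<lambda>i. c * v i | c. True}"

definition affine_cone :: "('i \<Rightarrow> complex) set set \<Rightarrow> ('i \<Rightarrow> complex) set" where
  "affine_cone C = insert (\<lambda>i. 0) (\<Union>C)"

text \<open>The linearly independent family \<open>w 0, \<dots>, w e\<close> is the choice of linear coordinates on the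
  span of the curve: it encodes an injective linear map from the space of dimension \<open>e + 1\<close>,
  under which the curve is the image of the standard one. As we speak of curves, \<open>e > 0\<close>.\<close>

definition rational_normal_curve :: "'i set \<Rightarrow> nat \<Rightarrow> ('i \<Rightarrow> complex) set set \<Rightarrow> bool" where
  "rational_normal_curve I e C \<longleftrightarrow> e > 0 \<and>
     (\<exists>w. (\<forall>k\<le>e. w k \<in> coord_space I) \<and>
          (\<forall>c. (\<forall>i. (\<Sum>k\<le>e. c k * w k i) = 0) \<longrightarrow> (\<forall>k\<le>e. c k = 0)) \<and>
          C = {proj_point (\<lambda>i. \<Sum>k\<le>e. s ^ (e - k) * t ^ k * w k i) | s t. (s, t) \<noteq> (0, 0)})"

definition hyperplane_section ::
    "'i set \<Rightarrow> ('i \<Rightarrow> complex) \<Rightarrow> ('i \<Rightarrow> complex) set set \<Rightarrow> ('i \<Rightarrow> complex) set set" where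
  "hyperplane_section I a C = {P \<in> C. \<forall>v\<in>P. (\<Sum>i\<in>I. a i * v i) = 0}"

text \<open>The degree of a projective curve is its number of intersection points with a general
  hyperplane. General means: with coefficient vector in some nonempty Zariski open set, which
  without loss of generality is the set where a single polynomial \<open>D\<close> does not vanish.\<close>

definition has_curve_degree :: "'i set \<Rightarrow> ('i \<Rightarrow> complex) set set \<Rightarrow> nat \<Rightarrow> bool" where
  "has_curve_degree I C d \<longleftrightarrow>
     (\<exists>D. poly_fun I D \<and> (\<exists>a\<in>coord_space I. D a \<noteq> 0) \<and>
          (\<forall>a\<in>coord_space I. D a \<noteq> 0 \<longrightarrow>
             finite (hyperplane_section I a C) \<and> card (hyperplane_section I a C) = d))"


section \<open>The reciprocal variety of a graph with one vertex colour and one edge colour\<close>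

definition simple_graph :: "nat \<Rightarrow> nat set set \<Rightarrow> bool" where
  "simple_graph n E \<longleftrightarrow> (\<forall>e\<in>E. e \<subseteq> {1..n} \<and> card e = 2)"

text \<open>Vertices are \<open>1, \<dots>, n\<close>, whereas matrix indices start at 0.\<close>

definition adjacency_mat :: "nat \<Rightarrow> nat set set \<Rightarrow> complex mat" where
  "adjacency_mat n E = mat n n (\<lambda>(i, j). if {Suc i, Suc j} \<in> E then 1 else 0)"

definition conc_mat :: "nat \<Rightarrow> nat set set \<Rightarrow> complex \<Rightarrow> complex \<Rightarrow> complex mat" where
  "conc_mat n E \<theta>1 \<theta>2 = \<theta>1 \<cdot>\<^sub>m 1\<^sub>m n + \<theta>2 \<cdot>\<^sub>m adjacency_mat n E"

definition upper_idx :: "nat \<Rightarrow> (nat \<times> nat) set" where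
  "upper_idx n = {(i, j). 1 \<le> i \<and> i \<le> j \<and> j \<le> n}"

definition upper_entries :: "nat \<Rightarrow> complex mat \<Rightarrow> nat \<times> nat \<Rightarrow> complex" where
  "upper_entries n B =
     (\<lambda>(i, j). if (i, j) \<in> upper_idx n then B $$ (i - 1, j - 1) else 0)"

definition reciprocal_image :: "nat \<Rightarrow> nat set set \<Rightarrow> (nat \<times> nat \<Rightarrow> complex) set" where
  "reciprocal_image n E =
     {upper_entries n B | B \<theta>1 \<theta>2. B \<in> carrier_mat n n \<and>
        inverts_mat (conc_mat n E \<theta>1 \<theta>2) B \<and> inverts_mat B (conc_mat n E \<theta>1 \<theta>2)}"

definition reciprocal_variety :: "nat \<Rightarrow> nat set set \<Rightarrow> (nat \<times> nat \<Rightarrow> complex) set" where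
  "reciprocal_variety n E = zariski_closure (upper_idx n) (reciprocal_image n E)"

end

theory Submission
  imports Defs "Subresultants.Subresultant_Gcd" "HOL-Computational_Algebra.Field_as_Ring"
    "HOL-Computational_Algebra.Fundamental_Theorem_Algebra"
begin

text \<open>
  Let \<open>f\<close> be the minimal polynomial of the adjacency matrix \<open>A\<close>, of degree \<open>e + 1\<close>, and \<open>P(s, t)\<close> the
  binary form of the same degree obtained from \<open>f\<close> by homogenising. Since \<open>f(A) = 0\<close>, dividing
  \<open>f(x) - f(X)\<close> by \<open>x - X\<close> and inserting \<open>X = A\<close> gives
  \<open>(s Id - t A) Q(s, t) = P(s, t) Id\<close> with \<open>Q(s, t) = \<Sum>k\<le>e. s\<^sup>e\<^sup>-\<^sup>k t\<^sup>k W k\<close>,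
  where \<open>W k\<close> is a polynomial of degree \<open>k\<close> in \<open>A\<close> (lemma \<open>horner_quotient\<close>). By minimality of \<open>f\<close>,
  the symmetric matrices \<open>W 0, \<dots>, W e\<close> are linearly independent. So the inverses of the invertible
  concentration matrices are exactly the nonzero multiples of the points \<open>Q(s, t)\<close> with
  \<open>P(s, t) \<noteq> 0\<close> (lemma \<open>reciprocal_image_moment_curve\<close>), and \<open>Q\<close> parametrises a rational normal
  curve of degree \<open>e\<close> in the linear coordinates given by the \<open>W k\<close>. Working with the \<open>W k\<close> rather than
  with spectral projections makes the diagonalisability of \<open>A\<close> relevant for the degree bound alone.

  The closure of this set is the whole cone over the curve
  (lemma \<open>zariski_closure_dense_part_of_cone\<close>). On the one hand, the cone is closed: it is
  defined by the linear equations of the span of the \<open>W k\<close> together with the 2 by 2 minors of the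
  rational normal curve. On the other hand, the condition \<open>P(s, t) \<noteq> 0\<close> removes only finitely many
  parameters from a general line in parameter space.

  The degree of the curve is \<open>e\<close>, because its hyperplane sections are the zero sets of
  binary forms of degree \<open>e\<close>, which have \<open>e\<close> distinct zeros unless the discriminant vanishes
  (lemma \<open>has_curve_degree_moment_lines\<close>). Finally, \<open>e > 0\<close> because a graph with an edge has a
  nonscalar adjacency matrix, and \<open>e + 1\<close> is at most the number of eigenvalues: the roots of \<open>f\<close> are
  eigenvalues, and they are simple as \<open>A\<close> is Hermitian
  (lemma \<open>degree_minimal_annihilator_le_spectrum\<close>).
\<close>

section \<open>Polynomial functions on a coordinate space\<close>

lemma poly_fun_sum:
  assumes "\<And>j. j \<in> J \<Longrightarrow> poly_fun I (p j)"
  shows "poly_fun I (\<lambda>x. \<Sum>j\<in>J. p j x)"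
  using assms by (induction J rule: infinite_finite_induct) (auto intro: poly_fun.intros)

lemma poly_fun_prod:
  assumes "\<And>j. j \<in> J \<Longrightarrow> poly_fun I (p j)"
  shows "poly_fun I (\<lambda>x. \<Prod>j\<in>J. p j x)"
  using assms by (induction J rule: infinite_finite_induct) (auto intro: poly_fun.intros)

lemma poly_fun_cmult: "poly_fun I p \<Longrightarrow> poly_fun I (\<lambda>x. c * p x)"
  by (intro poly_fun.mult poly_fun.const)

lemma poly_fun_diff:
  assumes "poly_fun I p" "poly_fun I q"
  shows "poly_fun I (\<lambda>x. p x - q x)"
  using poly_fun.add[OF assms(1) poly_fun_cmult[OF assms(2), of "-1"]] by simp

lemma poly_fun_if:
  "poly_fun I p \<Longrightarrow> poly_fun I q \<Longrightarrow> poly_fun I (\<lambda>x. if b then p x else q x)"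
  by (cases b) simp_all

lemma poly_fun_linear: "poly_fun I (\<lambda>x. \<Sum>i\<in>I. a i * x i)"
  by (intro poly_fun_sum poly_fun_cmult poly_fun.coord)

lemma poly_fun_det:
  assumes "\<And>i j. i < m \<Longrightarrow> j < m \<Longrightarrow> poly_fun I (\<lambda>x. M x i j)"
  shows "poly_fun I (\<lambda>x. det (mat m m (\<lambda>(i, j). M x i j)))"
proof -
  have "det (mat m m (\<lambda>(i, j). M x i j)) =
    (\<Sum>p\<in>{p. p permutes {0..<m}}. signof p * (\<Prod>i=0..<m. M x i (p i)))" for x
    by (subst det_def'[of _ m]) (auto intro!: sum.cong prod.cong simp: permutes_in_image)
  then show ?thesis
    by (auto intro!: poly_fun_sum poly_fun_cmult poly_fun_prod assms simp: permutes_in_image)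
qed

text \<open>Restricting a polynomial function to a polynomially parametrised curve leaves a univariate
  polynomial, for which having infinitely many zeros means being zero.\<close>

lemma poly_fun_along_curve:
  assumes "poly_fun I p"
  shows "\<exists>q. \<forall>z. p (\<lambda>i. poly (X i) z) = poly q z"
  using assms
proof induction
  case (const c)
  have "\<forall>z. c = poly [:c:] z" by simp
  then show ?case by blast
next
  case (coord i)
  then show ?case by blast
next
  case (add p q)
  then show ?case by (metis poly_add)
next
  case (mult p q)
  then show ?case by (metis poly_mult)
qed

section \<open>Binary forms and the moment curve in arbitrary linear coordinates\<close>

definition binary_form :: "nat \<Rightarrow> (nat \<Rightarrow> complex) \<Rightarrow> complex \<Rightarrow> complex \<Rightarrow> complex" where
  "binary_form d a s t = (\<Sum>k\<le>d. s ^ (d - k) * t ^ k * a k)"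

text \<open>The image of \<open>(s\<^sup>e, s\<^sup>e\<^sup>-\<^sup>1 t, \<dots>, t\<^sup>e)\<close> under the linear map with columns \<open>w k\<close>.\<close>

definition moment_curve ::
    "nat \<Rightarrow> (nat \<Rightarrow> 'i \<Rightarrow> complex) \<Rightarrow> complex \<Rightarrow> complex \<Rightarrow> 'i \<Rightarrow> complex" where
  "moment_curve e w s t = (\<lambda>i. binary_form e (\<lambda>k. w k i) s t)"

definition moment_lines :: "nat \<Rightarrow> (nat \<Rightarrow> 'i \<Rightarrow> complex) \<Rightarrow> ('i \<Rightarrow> complex) set set" where
  "moment_lines e w = {proj_point (moment_curve e w s t) | s t. (s, t) \<noteq> (0, 0)}"

definition independent_family :: "nat \<Rightarrow> (nat \<Rightarrow> 'i \<Rightarrow> complex) \<Rightarrow> bool" where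
  "independent_family e w \<longleftrightarrow>
     (\<forall>c. (\<forall>i. (\<Sum>k\<le>e. c k * w k i) = 0) \<longrightarrow> (\<forall>k\<le>e. c k = 0))"

lemma rational_normal_curve_iff:
  "rational_normal_curve I e C \<longleftrightarrow> e > 0 \<and>
     (\<exists>w. (\<forall>k\<le>e. w k \<in> coord_space I) \<and> independent_family e w \<and> C = moment_lines e w)"
  unfolding rational_normal_curve_def independent_family_def moment_lines_def moment_curve_def
    binary_form_def ..

lemma binary_form_scale: "binary_form d a (c * s) (c * t) = c ^ d * binary_form d a s t"
proof -
  have "c ^ (d - k) * c ^ k = c ^ d" if "k \<le> d" for k
    using that by (simp flip: power_add)
  then have "(c * s) ^ (d - k) * (c * t) ^ k * a k = c ^ d * (s ^ (d - k) * t ^ k * a k)"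
    if "k \<le> d" for k
    using that by (simp add: power_mult_distrib mult_ac)
  then show ?thesis
    unfolding binary_form_def sum_distrib_left by (intro sum.cong) auto
qed

lemma binary_form_0_right: "binary_form d a s 0 = s ^ d * a 0"
  unfolding binary_form_def by (subst sum.remove[of _ 0]) (auto intro!: sum.neutral)

lemma binary_form_0_left: "binary_form d a 0 t = t ^ d * a d"
  unfolding binary_form_def by (subst sum.remove[of _ d]) (auto intro!: sum.neutral)

lemma binary_form_1_left: "binary_form d a 1 t = (\<Sum>k\<le>d. a k * t ^ k)"
  by (simp add: binary_form_def mult.commute)

lemma moment_curve_scale:
  "moment_curve e w (c * s) (c * t) = (\<lambda>i. c ^ e * moment_curve e w s t i)"
  by (simp add: moment_curve_def binary_form_scale)

lemma moment_curve_in_coord_space: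
  assumes "\<forall>k\<le>e. w k \<in> coord_space I"
  shows "moment_curve e w s t \<in> coord_space I"
  using assms by (auto simp: coord_space_def moment_curve_def binary_form_def)

lemma proj_point_scale:
  assumes "c \<noteq> 0"
  shows "proj_point (\<lambda>i. c * v i) = proj_point v"
proof
  show "proj_point (\<lambda>i. c * v i) \<subseteq> proj_point v"
    unfolding proj_point_def by (auto simp flip: mult.assoc)
  have "(\<lambda>i. b * v i) = (\<lambda>i. (b / c) * (c * v i))" for b
    using assms by simp
  then show "proj_point v \<subseteq> proj_point (\<lambda>i. c * v i)"
    unfolding proj_point_def by blast
qed

lemma mem_cone_moment_lines:
  assumes "e > 0"
  shows "x \<in> affine_cone (moment_lines e w) \<longleftrightarrow> (\<exists>c s t. x = (\<lambda>i. c * moment_curve e w s t i))"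
proof
  assume "x \<in> affine_cone (moment_lines e w)"
  then consider "x = (\<lambda>i. 0 * moment_curve e w 0 0 i)"
    | s t where "x \<in> proj_point (moment_curve e w s t)"
    by (auto simp: affine_cone_def moment_lines_def)
  then show "\<exists>c s t. x = (\<lambda>i. c * moment_curve e w s t i)"
  proof cases
    case 1
    then show ?thesis by blast
  next
    case 2
    then show ?thesis unfolding proj_point_def by blast
  qed
next
  assume "\<exists>c s t. x = (\<lambda>i. c * moment_curve e w s t i)"
  then obtain c s t where x: "x = (\<lambda>i. c * moment_curve e w s t i)" by blast
  show "x \<in> affine_cone (moment_lines e w)"
  proof (cases "(s, t) = (0, 0)")
    case True
    with assms have "moment_curve e w s t i = 0" for i
      by (simp add: moment_curve_def binary_form_0_right)
    with x show ?thesis by (simp add: affine_cone_def)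
  next
    case False
    with x show ?thesis
      unfolding affine_cone_def moment_lines_def proj_point_def by blast
  qed
qed

section \<open>The cone over the moment curve as a Zariski closure\<close>

text \<open>The Gram matrix of an independent family is invertible, as a kernel vector is a linear
  combination of norm zero. So the members of the dual family can be taken to be conjugated
  linear combinations of the given ones.\<close>

lemma dual_family:
  fixes w :: "nat \<Rightarrow> 'i \<Rightarrow> complex"
  assumes fin: "finite I" and w: "\<forall>k\<le>e. w k \<in> coord_space I" and ind: "independent_family e w"
  obtains a where "\<And>k j. k \<le> e \<Longrightarrow> j \<le> e \<Longrightarrow> (\<Sum>i\<in>I. a k i * w j i) = (if k = j then 1 else 0)"
proof -
  define G where "G = mat (Suc e) (Suc e) (\<lambda>(k, j). \<Sum>i\<in>I. cnj (w k i) * w j i)"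
  have G: "G \<in> carrier_mat (Suc e) (Suc e)" by (simp add: G_def)
  have set_eq: "{0..<Suc e} = {..e}" by auto
  have "det G \<noteq> 0"
  proof
    assume "det G = 0"
    then obtain v where v: "v \<in> carrier_vec (Suc e)" "v \<noteq> 0\<^sub>v (Suc e)" "G *\<^sub>v v = 0\<^sub>v (Suc e)"
      using det_0_iff_vec_prod_zero[OF G] by blast
    define x where "x i = (\<Sum>k\<le>e. v $ k * w k i)" for i
    have Gv: "(\<Sum>j\<le>e. (\<Sum>i\<in>I. cnj (w k i) * w j i) * v $ j) = 0" if "k \<le> e" for k
    proof -
      have "(G *\<^sub>v v) $ k = (\<Sum>j\<le>e. (\<Sum>i\<in>I. cnj (w k i) * w j i) * v $ j)"
        using that v(1) by (simp add: G_def scalar_prod_def set_eq)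
      with v(3) that show ?thesis by simp
    qed
    have "(\<Sum>i\<in>I. cnj (x i) * x i) =
        (\<Sum>i\<in>I. \<Sum>k\<le>e. \<Sum>j\<le>e. cnj (v $ k) * (cnj (w k i) * w j i * v $ j))"
      unfolding x_def cnj_sum sum_product by (simp add: mult_ac)
    also have "\<dots> = (\<Sum>k\<le>e. \<Sum>j\<le>e. \<Sum>i\<in>I. cnj (v $ k) * (cnj (w k i) * w j i * v $ j))"
      by (subst sum.swap, intro sum.cong refl, rule sum.swap)
    also have "\<dots> = (\<Sum>k\<le>e. cnj (v $ k) * (\<Sum>j\<le>e. (\<Sum>i\<in>I. cnj (w k i) * w j i) * v $ j))"
      by (simp add: sum_distrib_left sum_distrib_right)
    also have "\<dots> = 0" by (simp add: Gv)
    finally have "(\<Sum>i\<in>I. cnj (x i) * x i) = 0" .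
    moreover have "(\<Sum>i\<in>I. cnj (x i) * x i) = of_real (\<Sum>i\<in>I. (cmod (x i))\<^sup>2)"
      unfolding of_real_sum by (intro sum.cong refl) (metis complex_norm_square mult.commute)
    ultimately have "(\<Sum>i\<in>I. (cmod (x i))\<^sup>2) = 0" by (metis of_real_eq_0_iff)
    then have "\<forall>i\<in>I. x i = 0" using fin by (simp add: sum_nonneg_eq_0_iff)
    moreover have "\<forall>i. i \<notin> I \<longrightarrow> x i = 0" using w by (simp add: x_def coord_space_def)
    ultimately have "\<forall>i. (\<Sum>k\<le>e. v $ k * w k i) = 0" by (auto simp: x_def)
    then have "\<forall>k\<le>e. v $ k = 0" using ind unfolding independent_family_def by blast
    with v(1) have "v = 0\<^sub>v (Suc e)" by (intro eq_vecI) auto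
    with v(2) show False by blast
  qed
  from det_non_zero_imp_unit[OF G this, of "()"] obtain H where
    H: "H \<in> carrier_mat (Suc e) (Suc e)" "H * G = 1\<^sub>m (Suc e)"
    by (auto simp: Units_def ring_mat_def)
  define a where "a k i = (\<Sum>l\<le>e. H $$ (k, l) * cnj (w l i))" for k i
  have "(\<Sum>i\<in>I. a k i * w j i) = (if k = j then 1 else 0)" if "k \<le> e" "j \<le> e" for k j
  proof -
    have "(\<Sum>i\<in>I. a k i * w j i) = (\<Sum>l\<le>e. H $$ (k, l) * (\<Sum>i\<in>I. cnj (w l i) * w j i))"
      unfolding a_def sum_distrib_left sum_distrib_right
      by (subst sum.swap) (simp add: mult_ac)
    also have "\<dots> = (H * G) $$ (k, j)"
      using that H(1) by (simp add: G_def scalar_prod_def set_eq)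
    finally show ?thesis using H(2) that by simp
  qed
  then show thesis by (rule that)
qed

lemma dual_family_coordinate:
  fixes w :: "nat \<Rightarrow> 'i \<Rightarrow> complex"
  assumes dual: "\<And>k j. k \<le> e \<Longrightarrow> j \<le> e \<Longrightarrow> (\<Sum>i\<in>I. a k i * w j i) = (if k = j then 1 else 0)"
    and k: "k \<le> e"
  shows "(\<Sum>i\<in>I. a k i * (\<Sum>j\<le>e. c j * w j i)) = c k"
proof -
  have "(\<Sum>i\<in>I. a k i * (\<Sum>j\<le>e. c j * w j i)) = (\<Sum>j\<le>e. c j * (\<Sum>i\<in>I. a k i * w j i))"
    by (simp add: sum_distrib_left sum.swap[of _ "{..e}" I] mult_ac)
  also have "\<dots> = (\<Sum>j\<le>e. if k = j then c j else 0)"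
    using k by (intro sum.cong) (auto simp: dual)
  also have "\<dots> = c k" using k by simp
  finally show ?thesis .
qed

text \<open>The determinantal equations of the rational normal curve: proportionality of
  \<open>(c 0, \<dots>, c (e - 1))\<close> and \<open>(c 1, \<dots>, c e)\<close> makes \<open>c\<close> a geometric progression, where
  \<open>c 0 = 0\<close> is the case of infinite ratio.\<close>

lemma geometric_progression_of_minors:
  fixes c :: "nat \<Rightarrow> complex"
  assumes minors: "\<And>i j. i < e \<Longrightarrow> j < e \<Longrightarrow> c i * c (Suc j) = c (Suc i) * c j"
  shows "\<exists>g s t. \<forall>k\<le>e. c k = g * (s ^ (e - k) * t ^ k)"
proof (cases "c 0 = 0")
  case False
  have geometric: "c k = c 0 * (c 1 / c 0) ^ k" if "k \<le> e" for k
    using that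
  proof (induction k)
    case (Suc k)
    then have "c 0 * c (Suc k) = c 1 * c k" using minors[of 0 k] by simp
    then have "c (Suc k) = (c 1 / c 0) * c k" using False by (simp add: field_simps)
    with Suc show ?case by simp
  qed simp
  have "\<forall>k\<le>e. c k = c 0 * (1 ^ (e - k) * (c 1 / c 0) ^ k)"
    unfolding power_one mult_1 using geometric by blast
  then show ?thesis by blast
next
  case True
  have "c k = 0" if "k < e" for k
    using that
  proof (induction k)
    case (Suc k)
    then show ?case using minors[of k "Suc k"] by simp
  qed (simp add: True)
  then have "\<forall>k\<le>e. c k = c e * (0 ^ (e - k) * 1 ^ k)" by (simp add: le_less)
  then show ?thesis by blast
qed

text \<open>The cone is Zariski closed, being cut out by the equations of the linear span of the curve
  and by the minors in the coordinates on this span that the dual family provides.\<close>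

lemma zariski_closure_subset_cone:
  assumes fin: "finite I" and w: "\<forall>k\<le>e. w k \<in> coord_space I" and ind: "independent_family e w"
    and e: "e > 0" and S: "S \<subseteq> affine_cone (moment_lines e w)"
  shows "zariski_closure I S \<subseteq> affine_cone (moment_lines e w)"
proof
  fix x assume x: "x \<in> zariski_closure I S"
  obtain a where dual: "\<And>k j. k \<le> e \<Longrightarrow> j \<le> e \<Longrightarrow> (\<Sum>i\<in>I. a k i * w j i) = (if k = j then 1 else 0)"
    using dual_family[OF fin w ind] by blast
  define l where "l k y = (\<Sum>i\<in>I. a k i * y i)" for k y
  have poly_l: "poly_fun I (l k)" for k
    unfolding l_def by (rule poly_fun_linear)
  have l_S: "\<exists>c s t. y = (\<lambda>i. c * moment_curve e w s t i) \<and> (\<forall>k\<le>e. l k y = c * (s ^ (e - k) * t ^ k))"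
    if yS: "y \<in> S" for y
  proof -
    from yS S have "y \<in> affine_cone (moment_lines e w)" by blast
    then obtain c s t where y: "y = (\<lambda>i. c * moment_curve e w s t i)"
      unfolding mem_cone_moment_lines[OF e] by blast
    then have "y = (\<lambda>i. \<Sum>k\<le>e. c * (s ^ (e - k) * t ^ k) * w k i)"
      by (simp add: moment_curve_def binary_form_def sum_distrib_left mult.assoc)
    then have "\<forall>k\<le>e. l k y = c * (s ^ (e - k) * t ^ k)"
      using dual_family_coordinate[OF dual, where c = "\<lambda>k. c * (s ^ (e - k) * t ^ k)"]
      by (simp add: l_def)
    with y show ?thesis by blast
  qed
  have span: "x i = (\<Sum>k\<le>e. l k x * w k i)" for i
  proof (cases "i \<in> I")
    case True
    have "poly_fun I (\<lambda>y. y i - (\<Sum>k\<le>e. w k i * l k y))"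
      by (intro poly_fun_diff poly_fun.coord True poly_fun_sum poly_fun_cmult poly_l)
    moreover have "\<forall>y\<in>S. y i - (\<Sum>k\<le>e. w k i * l k y) = 0"
    proof
      fix y assume "y \<in> S"
      from l_S[OF this] obtain c s t where
        y: "y = (\<lambda>i. c * moment_curve e w s t i)" and l: "\<And>k. k \<le> e \<Longrightarrow> l k y = c * (s ^ (e - k) * t ^ k)"
        by blast
      have "(\<Sum>k\<le>e. w k i * l k y) = (\<Sum>k\<le>e. w k i * (c * (s ^ (e - k) * t ^ k)))"
        by (intro sum.cong) (auto simp: l)
      also have "\<dots> = y i"
        by (simp add: y moment_curve_def binary_form_def sum_distrib_left mult_ac)
      finally show "y i - (\<Sum>k\<le>e. w k i * l k y) = 0" by simp
    qed
    ultimately have "x i - (\<Sum>k\<le>e. w k i * l k x) = 0"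
      using x unfolding zariski_closure_def by blast
    then show ?thesis by (simp add: mult.commute)
  next
    case False
    with x w show ?thesis by (simp add: zariski_closure_def coord_space_def)
  qed
  have minors: "l i x * l (Suc j) x = l (Suc i) x * l j x" if ij: "i < e" "j < e" for i j
  proof -
    have "poly_fun I (\<lambda>y. l i y * l (Suc j) y - l (Suc i) y * l j y)"
      by (intro poly_fun_diff poly_fun.mult poly_l)
    moreover have "\<forall>y\<in>S. l i y * l (Suc j) y - l (Suc i) y * l j y = 0"
    proof
      fix y assume "y \<in> S"
      from l_S[OF this] obtain c s t where l: "\<And>k. k \<le> e \<Longrightarrow> l k y = c * (s ^ (e - k) * t ^ k)"
        by blast
      have "e - i = Suc (e - Suc i)" "e - j = Suc (e - Suc j)" using ij by auto
      then show "l i y * l (Suc j) y - l (Suc i) y * l j y = 0"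
        using ij by (simp add: l)
    qed
    ultimately have "l i x * l (Suc j) x - l (Suc i) x * l j x = 0"
      using x unfolding zariski_closure_def by blast
    then show ?thesis by simp
  qed
  obtain c s t where c: "\<And>k. k \<le> e \<Longrightarrow> l k x = c * (s ^ (e - k) * t ^ k)"
    using geometric_progression_of_minors[of e "\<lambda>k. l k x"] minors by blast
  have "x i = c * moment_curve e w s t i" for i
    unfolding span[of i] moment_curve_def binary_form_def sum_distrib_left
    by (intro sum.cong) (auto simp: c)
  then show "x \<in> affine_cone (moment_lines e w)"
    unfolding mem_cone_moment_lines[OF e] by blast
qed

text \<open>An arbitrary point of the cone is joined to a point with parameters \<open>(c, s, t) = (1, 1, 0)\<close>,
  where \<open>P\<close> does not vanish. Along the line in parameter space, all but finitely many points
  belong to the given set, so a polynomial that vanishes there vanishes along the whole line.\<close>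

lemma zariski_closure_dense_part_of_cone:
  assumes fin: "finite I" and w: "\<forall>k\<le>e. w k \<in> coord_space I" and ind: "independent_family e w"
    and e: "e > 0" and P: "P 0 \<noteq> 0"
  shows "zariski_closure I {\<lambda>i. c * moment_curve e w s t i | c s t. c \<noteq> 0 \<and> binary_form d P s t \<noteq> 0}
    = affine_cone (moment_lines e w)"
    (is "zariski_closure I ?S = ?K")
proof
  have "?S \<subseteq> ?K" using mem_cone_moment_lines[OF e] by blast
  then show "zariski_closure I ?S \<subseteq> ?K"
    by (rule zariski_closure_subset_cone[OF fin w ind e])
  show "?K \<subseteq> zariski_closure I ?S"
  proof
    fix x assume "x \<in> ?K"
    then obtain c s t where x: "x = (\<lambda>i. c * moment_curve e w s t i)"
      unfolding mem_cone_moment_lines[OF e] by blast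
    have "p x = 0" if p: "poly_fun I p" and p0: "\<forall>y\<in>?S. p y = 0" for p
    proof -
      define cz sz tz where "cz = [:c, 1 - c:]" and "sz = [:s, 1 - s:]" and "tz = [:t, - t:]"
      define X where "X i = cz * (\<Sum>k\<le>e. Polynomial.smult (w k i) (sz ^ (e - k) * tz ^ k))" for i
      define Pz where "Pz = (\<Sum>k\<le>d. Polynomial.smult (P k) (sz ^ (d - k) * tz ^ k))"
      have X: "poly (X i) z = poly cz z * moment_curve e w (poly sz z) (poly tz z) i" for i z
        by (simp add: X_def moment_curve_def binary_form_def poly_sum mult_ac)
      have Pz: "poly Pz z = binary_form d P (poly sz z) (poly tz z)" for z
        by (simp add: Pz_def binary_form_def poly_sum mult_ac)
      obtain q where q: "\<And>z. p (\<lambda>i. poly (X i) z) = poly q z"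
        using poly_fun_along_curve[OF p] by metis
      have "poly (cz * Pz * q) z = 0" for z
      proof (cases "poly cz z = 0 \<or> poly Pz z = 0")
        case False
        then have "(\<lambda>i. poly (X i) z) \<in> ?S" unfolding X Pz by blast
        with p0 have "poly q z = 0" by (simp flip: q)
        then show ?thesis by simp
      qed auto
      then have "cz * Pz * q = 0" using poly_all_0_iff_0 by blast
      moreover have "poly (cz * Pz) 1 \<noteq> 0"
        by (simp add: Pz) (simp add: cz_def sz_def tz_def binary_form_0_right P)
      ultimately have "q = 0" by auto
      then have "p (\<lambda>i. poly (X i) 0) = 0" by (simp add: q)
      moreover have "(\<lambda>i. poly (X i) 0) = x"
        by (simp add: X x) (simp add: cz_def sz_def tz_def)
      ultimately show ?thesis by simp
    qed
    moreover have "x \<in> coord_space I"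
      using moment_curve_in_coord_space[OF w, of s t] by (simp add: x coord_space_def)
    ultimately show "x \<in> zariski_closure I ?S" unfolding zariski_closure_def by blast
  qed
qed

section \<open>The degree of the rational normal curve\<close>

lemma card_roots_rsquarefree:
  fixes p :: "complex poly"
  assumes "rsquarefree p"
  shows "card {z. poly p z = 0} = degree p"
proof -
  have "p \<noteq> 0" using assms by (simp add: rsquarefree_def)
  have "degree p = degree (Polynomial.smult (lead_coeff p) (\<Prod>z|poly p z = 0. [:-z, 1:]))"
    using complex_poly_decompose_rsquarefree[OF assms] by simp
  also have "\<dots> = degree (\<Prod>z|poly p z = 0. [:-z, 1:])"
    using \<open>p \<noteq> 0\<close> by simp
  also have "\<dots> = (\<Sum>z|poly p z = 0. degree [:-z, 1:])"
    by (rule degree_prod_eq_sum_degree) auto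
  finally show ?thesis by simp
qed

lemma resultant_pderiv_eq_0_iff:
  fixes p :: "complex poly"
  assumes "p \<noteq> 0"
  shows "resultant p (pderiv p) = 0 \<longleftrightarrow> \<not> rsquarefree p"
proof -
  have "degree (gcd p (pderiv p)) \<noteq> 0 \<longleftrightarrow> (\<exists>z. poly (gcd p (pderiv p)) z = 0)"
  proof
    assume "degree (gcd p (pderiv p)) \<noteq> 0"
    then show "\<exists>z. poly (gcd p (pderiv p)) z = 0"
      by (metis fundamental_theorem_of_algebra constant_degree)
  next
    assume "\<exists>z. poly (gcd p (pderiv p)) z = 0"
    moreover have "gcd p (pderiv p) \<noteq> 0" using assms by simp
    ultimately show "degree (gcd p (pderiv p)) \<noteq> 0"
      by (metis degree_eq_zeroE poly_const_conv pCons_0_0)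
  qed
  also have "\<dots> \<longleftrightarrow> (\<exists>z. poly p z = 0 \<and> poly (pderiv p) z = 0)"
    by (simp add: poly_eq_0_iff_dvd)
  finally show ?thesis by (simp add: resultant_0_gcd rsquarefree_roots)
qed

text \<open>A hyperplane with coefficients \<open>a\<close> meets the curve in the zeros of the binary form with
  coefficients \<open>\<alpha> a k\<close>, where \<open>\<alpha> a k\<close> is the value of the hyperplane's equation at \<open>w k\<close>.
  If \<open>\<alpha> a e \<noteq> 0\<close>, then \<open>[0 : 1]\<close> is not among them, and the others are the roots of a
  polynomial of degree \<open>e\<close>. So the hyperplane is general as soon as, in addition, the
  discriminant of this polynomial does not vanish. The polynomial \<open>z ^ e - 1\<close> shows that general
  hyperplanes exist. The Sylvester matrix needs its explicit size \<open>e + (e - 1)\<close> to have entries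
  that are polynomial in \<open>a\<close>: the actual degrees drop for special \<open>a\<close>.\<close>

lemma has_curve_degree_moment_lines:
  assumes fin: "finite I" and w: "\<forall>k\<le>e. w k \<in> coord_space I" and ind: "independent_family e w"
    and e: "e > 0"
  shows "has_curve_degree I (moment_lines e w) e"
proof -
  define \<alpha> where "\<alpha> a k = (\<Sum>i\<in>I. a i * w k i)" for a k
  define h where "h a = (\<Sum>k\<le>e. monom (\<alpha> a k) k)" for a
  define D where
    "D a = \<alpha> a e * det (sylvester_mat_sub e (e - 1) (h a) (pderiv (h a)))" for a
  have coeff_h: "coeff (h a) k = (if k \<le> e then \<alpha> a k else 0)" for a k
    by (simp add: h_def coeff_sum)
  have poly_h: "poly (h a) z = binary_form e (\<alpha> a) 1 z" for a z
    by (simp add: h_def poly_sum poly_monom binary_form_1_left)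
  have degree_h: "degree (h a) = e" if "\<alpha> a e \<noteq> 0" for a
    using that by (intro antisym degree_le le_degree) (auto simp: coeff_h)
  have D_iff: "D a \<noteq> 0 \<longleftrightarrow> \<alpha> a e \<noteq> 0 \<and> rsquarefree (h a)" for a
  proof (cases "\<alpha> a e = 0")
    case False
    then have "h a \<noteq> 0" using coeff_h[of a e] by auto
    moreover have "D a = \<alpha> a e * resultant (h a) (pderiv (h a))"
      by (simp add: D_def resultant_def sylvester_mat_def degree_pderiv degree_h[OF False])
    ultimately show ?thesis using False by (simp add: resultant_pderiv_eq_0_iff)
  qed (simp add: D_def)
  have poly_\<alpha>: "poly_fun I (\<lambda>a. \<alpha> a k)" for k
    unfolding \<alpha>_def by (simp add: mult.commute[of _ "w k _"] poly_fun_linear)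
  have poly_coeff_h: "poly_fun I (\<lambda>a. coeff (h a) k)" for k
    by (cases "k \<le> e") (auto simp: coeff_h poly_\<alpha> poly_fun.const)
  have poly_coeff_pderiv_h: "poly_fun I (\<lambda>a. coeff (pderiv (h a)) k)" for k
    unfolding coeff_pderiv by (intro poly_fun_cmult poly_coeff_h)
  have poly_entry: "poly_fun I (\<lambda>a.
      if i < e - 1 then if i \<le> j \<and> j - i \<le> e then coeff (h a) (e + i - j) else 0
      else if i - (e - 1) \<le> j \<and> j \<le> i then coeff (pderiv (h a)) (i - j) else 0)" for i j
    by (intro poly_fun_if poly_coeff_h poly_coeff_pderiv_h poly_fun.const)
  have poly_D: "poly_fun I D"
    unfolding D_def sylvester_mat_sub_def
    by (intro poly_fun.mult poly_\<alpha> poly_fun_det poly_entry)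
  moreover have "\<exists>a\<in>coord_space I. D a \<noteq> 0"
  proof -
    obtain b where dual: "\<And>k j. k \<le> e \<Longrightarrow> j \<le> e \<Longrightarrow> (\<Sum>i\<in>I. b k i * w j i) = (if k = j then 1 else 0)"
      using dual_family[OF fin w ind] by blast
    define a where "a i = (if i \<in> I then b e i - b 0 i else 0)" for i
    have \<alpha>: "\<alpha> a k = (if k = e then 1 else 0) - (if k = 0 then 1 else 0)" if "k \<le> e" for k
    proof -
      have "\<alpha> a k = (\<Sum>i\<in>I. b e i * w k i) - (\<Sum>i\<in>I. b 0 i * w k i)"
        by (simp add: \<alpha>_def a_def left_diff_distrib sum_subtractf)
      with that show ?thesis by (simp add: dual)
    qed
    have h: "h a = monom 1 e - 1"
      using e by (intro poly_eqI) (auto simp: coeff_h \<alpha> coeff_1)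
    have "rsquarefree (h a)"
      unfolding rsquarefree_roots using e
      by (auto simp: h poly_monom pderiv_diff pderiv_monom power_0_left)
    moreover have "\<alpha> a e \<noteq> 0" using e by (simp add: \<alpha>)
    ultimately have "D a \<noteq> 0" by (simp add: D_iff)
    moreover have "a \<in> coord_space I" by (simp add: a_def coord_space_def)
    ultimately show ?thesis by blast
  qed
  moreover have "finite (hyperplane_section I a (moment_lines e w)) \<and>
      card (hyperplane_section I a (moment_lines e w)) = e" if "D a \<noteq> 0" for a
  proof -
    have lead: "\<alpha> a e \<noteq> 0" and sqf: "rsquarefree (h a)" using that by (auto simp: D_iff)
    define line where "line z = proj_point (moment_curve e w 1 z)" for z
    define R where "R = {z. poly (h a) z = 0}"
    have equation_on_curve: "(\<Sum>i\<in>I. a i * moment_curve e w s t i) = binary_form e (\<alpha> a) s t" for s t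
      unfolding moment_curve_def binary_form_def \<alpha>_def
      by (simp add: sum_distrib_left sum.swap[of _ "{..e}" I] mult_ac)
    have section_iff: "(\<forall>v\<in>proj_point (moment_curve e w s t). (\<Sum>i\<in>I. a i * v i) = 0) \<longleftrightarrow>
        binary_form e (\<alpha> a) s t = 0" for s t
    proof -
      have scaled: "(\<Sum>i\<in>I. a i * (c * moment_curve e w s t i)) = c * binary_form e (\<alpha> a) s t" for c
        unfolding equation_on_curve[symmetric] by (simp add: sum_distrib_left mult_ac)
      have "(\<forall>v\<in>proj_point (moment_curve e w s t). (\<Sum>i\<in>I. a i * v i) = 0) \<longleftrightarrow>
          (\<forall>c. c * binary_form e (\<alpha> a) s t = 0)"
        unfolding proj_point_def scaled[symmetric] by fast
      also have "\<dots> \<longleftrightarrow> binary_form e (\<alpha> a) s t = 0"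
        by (metis mult_1 mult_zero_right)
      finally show ?thesis .
    qed
    have eq: "hyperplane_section I a (moment_lines e w) = line ` R"
    proof
      show "line ` R \<subseteq> hyperplane_section I a (moment_lines e w)"
        unfolding hyperplane_section_def moment_lines_def line_def R_def poly_h
        using section_iff by fastforce
      show "hyperplane_section I a (moment_lines e w) \<subseteq> line ` R"
      proof
        fix L assume "L \<in> hyperplane_section I a (moment_lines e w)"
        then obtain s t where L: "L = proj_point (moment_curve e w s t)" "(s, t) \<noteq> (0, 0)"
          and 0: "binary_form e (\<alpha> a) s t = 0"
          unfolding hyperplane_section_def moment_lines_def using section_iff by blast
        have "s \<noteq> 0"
        proof
          assume "s = 0"
          with 0 lead L(2) show False by (simp add: binary_form_0_left)
        qed
        then have st: "s = s * 1" "t = s * (t / s)" by auto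
        have "binary_form e (\<alpha> a) 1 (t / s) = 0"
          using 0 binary_form_scale[of e "\<alpha> a" s 1 "t / s"] \<open>s \<noteq> 0\<close> by simp
        moreover have "L = line (t / s)"
          using moment_curve_scale[of e w s 1 "t / s"] \<open>s \<noteq> 0\<close>
          by (simp add: L(1) line_def proj_point_scale)
        ultimately show "L \<in> line ` R" by (auto simp: R_def poly_h)
      qed
    qed
    have "inj line"
    proof
      fix y z assume "line y = line z"
      moreover have "moment_curve e w 1 z \<in> line z"
        unfolding line_def proj_point_def by (auto intro: exI[of _ 1])
      ultimately obtain c where c: "moment_curve e w 1 z = (\<lambda>i. c * moment_curve e w 1 y i)"
        unfolding line_def proj_point_def by auto
      have "(\<Sum>k\<le>e. (z ^ k - c * y ^ k) * w k i) = 0" for i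
        using fun_cong[OF c, of i]
        by (simp add: moment_curve_def binary_form_def left_diff_distrib sum_subtractf
            sum_distrib_left mult.assoc)
      then have "\<forall>k\<le>e. z ^ k - c * y ^ k = 0"
        using spec[OF ind[unfolded independent_family_def], of "\<lambda>k. z ^ k - c * y ^ k"] by blast
      from this[rule_format, of 0] this[rule_format, of 1] e show "y = z" by simp
    qed
    moreover have "finite R" "card R = e"
      using card_roots_rsquarefree[OF sqf] degree_h[OF lead] e
      by (auto simp: R_def intro: card_ge_0_finite)
    ultimately show ?thesis
      unfolding eq by (simp add: card_image inj_on_subset)
  qed
  ultimately show ?thesis unfolding has_curve_degree_def by blast
qed

section \<open>Polynomials of a square matrix\<close>

definition mat_poly :: "'a :: comm_ring_1 mat \<Rightarrow> 'a poly \<Rightarrow> 'a mat" where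
  "mat_poly A p =
     mat (dim_row A) (dim_row A) (\<lambda>(i, j). \<Sum>k\<le>degree p. coeff p k * (A ^\<^sub>m k) $$ (i, j))"

context
  fixes A :: "'a :: comm_ring_1 mat" and n :: nat
  assumes A: "A \<in> carrier_mat n n"
begin

lemma mat_poly_carrier [simp, intro]: "mat_poly A p \<in> carrier_mat n n"
  using A by (simp add: mat_poly_def)

lemma mat_poly_dim [simp]: "dim_row (mat_poly A p) = n" "dim_col (mat_poly A p) = n"
  using A by (simp_all add: mat_poly_def)

lemma mat_poly_index:
  assumes "i < n" "j < n" "degree p \<le> N"
  shows "mat_poly A p $$ (i, j) = (\<Sum>k\<le>N. coeff p k * (A ^\<^sub>m k) $$ (i, j))"
proof -
  have "mat_poly A p $$ (i, j) = (\<Sum>k\<le>degree p. coeff p k * (A ^\<^sub>m k) $$ (i, j))"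
    using A assms by (simp add: mat_poly_def)
  also have "\<dots> = (\<Sum>k\<le>N. coeff p k * (A ^\<^sub>m k) $$ (i, j))"
    using assms by (intro sum.mono_neutral_left) (auto simp: coeff_eq_0)
  finally show ?thesis .
qed

lemma mat_poly_0 [simp]: "mat_poly A 0 = 0\<^sub>m n n"
  by (intro eq_matI) (auto simp: mat_poly_index[of _ _ _ 0])

lemma mat_poly_add: "mat_poly A (p + q) = mat_poly A p + mat_poly A q"
proof (intro eq_matI)
  fix i j assume "i < dim_row (mat_poly A p + mat_poly A q)" "j < dim_col (mat_poly A p + mat_poly A q)"
  then have "i < n" "j < n" by auto
  then show "mat_poly A (p + q) $$ (i, j) = (mat_poly A p + mat_poly A q) $$ (i, j)"
    using degree_add_le_max[of p q]
    by (simp add: mat_poly_index[of _ _ _ "max (degree p) (degree q)"] sum.distrib distrib_right)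
qed auto

lemma mat_poly_smult: "mat_poly A (Polynomial.smult c p) = c \<cdot>\<^sub>m mat_poly A p"
  by (intro eq_matI) (auto simp: mat_poly_index[of _ _ _ "degree p"] degree_smult_le
      sum_distrib_left mult.assoc)

lemma mat_poly_sum_index:
  assumes "i < n" "j < n"
  shows "mat_poly A (\<Sum>k\<in>K. Polynomial.smult (c k) (r k)) $$ (i, j) =
    (\<Sum>k\<in>K. c k * mat_poly A (r k) $$ (i, j))"
  using assms by (induction K rule: infinite_finite_induct)
    (auto simp: mat_poly_add mat_poly_smult)

lemma mat_poly_pCons: "mat_poly A (pCons a p) = a \<cdot>\<^sub>m 1\<^sub>m n + mat_poly A p * A"
proof (intro eq_matI)
  fix i j assume "i < dim_row (a \<cdot>\<^sub>m 1\<^sub>m n + mat_poly A p * A)"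
    and "j < dim_col (a \<cdot>\<^sub>m 1\<^sub>m n + mat_poly A p * A)"
  then have ij: "i < n" "j < n" using A by auto
  have pow: "(A ^\<^sub>m Suc k) $$ (i, j) = (\<Sum>l\<in>{0..<n}. (A ^\<^sub>m k) $$ (i, l) * A $$ (l, j))" for k
    using A ij pow_carrier_mat[OF A, of k] by (simp add: scalar_prod_def)
  have "mat_poly A (pCons a p) $$ (i, j) =
      (\<Sum>k\<le>Suc (degree p). coeff (pCons a p) k * (A ^\<^sub>m k) $$ (i, j))"
    using ij by (intro mat_poly_index degree_pCons_le)
  also have "\<dots> = a * (A ^\<^sub>m 0) $$ (i, j) + (\<Sum>k\<le>degree p. coeff p k * (A ^\<^sub>m Suc k) $$ (i, j))"
    by (subst sum.atMost_Suc_shift) simp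
  also have "(\<Sum>k\<le>degree p. coeff p k * (A ^\<^sub>m Suc k) $$ (i, j)) =
      (\<Sum>l\<in>{0..<n}. mat_poly A p $$ (i, l) * A $$ (l, j))"
    unfolding pow using ij
    by (simp add: mat_poly_index[of _ _ _ "degree p"] sum_distrib_left sum_distrib_right
        sum.swap[of _ "{0..<n}"] mult.assoc del: pow_mat.simps)
  also have "\<dots> = (mat_poly A p * A) $$ (i, j)"
    using A ij by (simp add: scalar_prod_def)
  finally show "mat_poly A (pCons a p) $$ (i, j) = (a \<cdot>\<^sub>m 1\<^sub>m n + mat_poly A p * A) $$ (i, j)"
    using A ij by simp
qed (use A in auto)

lemma mat_poly_pCons_0: "mat_poly A (pCons 0 p) = mat_poly A p * A"
proof -
  have "0 \<cdot>\<^sub>m 1\<^sub>m n + B = B" if "B \<in> carrier_mat n n" for B :: "'a mat"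
    using that by (intro eq_matI) auto
  from this[OF mult_carrier_mat[OF mat_poly_carrier A]] show ?thesis
    unfolding mat_poly_pCons .
qed

lemma mat_poly_const: "mat_poly A [:a:] = a \<cdot>\<^sub>m 1\<^sub>m n"
  using A by (simp add: mat_poly_pCons)

lemma mat_poly_linear: "mat_poly A [:a, b:] = a \<cdot>\<^sub>m 1\<^sub>m n + b \<cdot>\<^sub>m A"
proof -
  have "b \<cdot>\<^sub>m 1\<^sub>m n * A = b \<cdot>\<^sub>m A"
    using A by (simp add: mult_smult_assoc_mat[of _ n n _ n])
  then show ?thesis by (simp add: mat_poly_pCons[of a] mat_poly_const)
qed

lemma mat_poly_X: "mat_poly A [:0, 1:] = A"
  using A unfolding mat_poly_linear by (intro eq_matI) auto

lemma mat_poly_mult: "mat_poly A (p * q) = mat_poly A p * mat_poly A q"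
proof (induction q)
  case 0
  show ?case by (simp add: right_mult_zero_mat[OF mat_poly_carrier])
next
  case (pCons a q)
  let ?P = "mat_poly A p" and ?Q = "mat_poly A q"
  have "mat_poly A (p * pCons a q) = a \<cdot>\<^sub>m ?P + (?P * ?Q) * A"
    using A pCons.IH by (simp add: mat_poly_add mat_poly_smult mat_poly_pCons_0)
  also have "(?P * ?Q) * A = ?P * (?Q * A)"
    using A by (intro assoc_mult_mat[of _ n n _ n _ n]) auto
  also have "a \<cdot>\<^sub>m ?P = ?P * (a \<cdot>\<^sub>m 1\<^sub>m n)"
    by (simp add: mult_smult_distrib[of _ n n _ n])
  also have "?P * (a \<cdot>\<^sub>m 1\<^sub>m n) + ?P * (?Q * A) = ?P * (a \<cdot>\<^sub>m 1\<^sub>m n + ?Q * A)"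
    using A by (intro mult_add_distrib_mat[symmetric, of _ n n _ n]) auto
  finally show ?case by (simp add: mat_poly_pCons)
qed

lemma mat_poly_eq_0_dvd:
  assumes "mat_poly A p = 0\<^sub>m n n" "p dvd q"
  shows "mat_poly A q = 0\<^sub>m n n"
  using assms by (auto simp: mat_poly_mult left_mult_zero_mat[OF mat_poly_carrier])

text \<open>The case \<open>\<sigma> = id\<close> says that polynomials of a symmetric matrix are symmetric, and complex
  conjugation describes the adjoint of a polynomial of a Hermitian matrix.\<close>

lemma mat_poly_twisted_transpose:
  assumes \<sigma>: "comm_ring_hom \<sigma>"
    and sym: "\<And>i j. i < n \<Longrightarrow> j < n \<Longrightarrow> \<sigma> (A $$ (j, i)) = A $$ (i, j)"
    and ij: "i < n" "j < n"
  shows "mat_poly A (map_poly \<sigma> p) $$ (i, j) = \<sigma> (mat_poly A p $$ (j, i))"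
proof -
  interpret comm_ring_hom \<sigma> by fact
  have pow: "\<sigma> ((A ^\<^sub>m k) $$ (j, i)) = (A ^\<^sub>m k) $$ (i, j)" if "i < n" "j < n" for k i j
    using that
  proof (induction k arbitrary: i j)
    case 0
    with A show ?case by simp
  next
    case (Suc k)
    have Ak: "A ^\<^sub>m k \<in> carrier_mat n n" using A by (rule pow_carrier_mat)
    have "A ^\<^sub>m Suc k = A * A ^\<^sub>m k"
    proof (induction k)
      case 0
      show ?case using A by simp
    next
      case (Suc k)
      then show ?case
        using A pow_carrier_mat[OF A, of k] by (simp add: assoc_mult_mat[of _ n n _ n _ n])
    qed
    then have "\<sigma> ((A ^\<^sub>m Suc k) $$ (j, i)) = \<sigma> (\<Sum>l\<in>{0..<n}. A $$ (j, l) * (A ^\<^sub>m k) $$ (l, i))"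
      using Suc.prems A Ak by (simp add: scalar_prod_def)
    also have "\<dots> = (\<Sum>l\<in>{0..<n}. (A ^\<^sub>m k) $$ (i, l) * A $$ (l, j))"
      using Suc by (simp add: hom_sum hom_mult sym mult.commute)
    also have "\<dots> = (A ^\<^sub>m Suc k) $$ (i, j)"
      using Suc.prems A Ak by (simp add: scalar_prod_def)
    finally show ?case .
  qed
  show ?thesis
    using ij by (simp add: mat_poly_index[of _ _ _ "degree p"] degree_map_poly_le hom_sum hom_mult
        pow coeff_map_poly)
qed

end

text \<open>The powers of an \<open>n \<times> n\<close> matrix lie in a space of dimension \<open>n\<^sup>2\<close>. So among \<open>n\<^sup>2 + 1\<close> of
  them there is a linear relation: a system of \<open>n\<^sup>2\<close> homogeneous equations, here padded by a
  zero row to become square, in \<open>n\<^sup>2 + 1\<close> unknowns.\<close>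

lemma annihilating_polynomial_exists:
  fixes A :: "'a :: field mat"
  assumes A: "A \<in> carrier_mat n n"
  shows "\<exists>f. f \<noteq> 0 \<and> mat_poly A f = 0\<^sub>m n n"
proof -
  define N where "N = n * n"
  define M where
    "M = mat (Suc N) (Suc N) (\<lambda>(r, k). if r < N then (A ^\<^sub>m k) $$ (r div n, r mod n) else 0)"
  have M: "M \<in> carrier_mat (Suc N) (Suc N)" by (simp add: M_def)
  have "det M = (\<Sum>p\<in>{p. p permutes {0..<Suc N}}. signof p * (\<Prod>i=0..<Suc N. M $$ (i, p i)))"
    by (rule det_def'[OF M])
  also have "\<dots> = 0"
  proof (rule sum.neutral, safe)
    fix p assume "p permutes {0..<Suc N}"
    then have "p N < Suc N" using permutes_in_image[of p "{0..<Suc N}" N] by auto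
    then have "M $$ (N, p N) = 0" by (simp add: M_def)
    then show "signof p * (\<Prod>i=0..<Suc N. M $$ (i, p i)) = 0" by simp
  qed
  finally obtain v where v: "v \<in> carrier_vec (Suc N)" "v \<noteq> 0\<^sub>v (Suc N)" "M *\<^sub>v v = 0\<^sub>v (Suc N)"
    using det_0_iff_vec_prod_zero[OF M] by blast
  define f where "f = (\<Sum>k\<le>N. monom (v $ k) k)"
  have coeff_f: "coeff f k = (if k \<le> N then v $ k else 0)" for k
    by (simp add: f_def coeff_sum)
  have "f \<noteq> 0"
  proof
    assume "f = 0"
    then have "v $ k = 0" if "k \<le> N" for k using coeff_f[of k] that by simp
    with v(1) have "v = 0\<^sub>v (Suc N)" by (intro eq_vecI) auto
    with v(2) show False by blast
  qed
  moreover have "mat_poly A f = 0\<^sub>m n n"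
  proof (intro eq_matI)
    fix i j assume "i < dim_row (0\<^sub>m n n)" "j < dim_col (0\<^sub>m n n)"
    then have ij: "i < n" "j < n" by auto
    have "i * n + j < Suc i * n" using ij by simp
    also have "\<dots> \<le> N" unfolding N_def using ij by (intro mult_le_mono1) simp
    finally have r: "i * n + j < N" .
    have "(\<Sum>k\<le>N. (A ^\<^sub>m k) $$ (i, j) * v $ k) = (M *\<^sub>v v) $ (i * n + j)"
      using r ij v(1)
      by (simp add: M_def scalar_prod_def lessThan_Suc_atMost flip: lessThan_atLeast0)
    then have "(\<Sum>k\<le>N. (A ^\<^sub>m k) $$ (i, j) * v $ k) = 0" using v(3) r by simp
    moreover have "degree f \<le> N" by (rule degree_le) (simp add: coeff_f)
    ultimately show "mat_poly A f $$ (i, j) = 0\<^sub>m n n $$ (i, j)"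
      using ij by (simp add: mat_poly_index[OF A ij] coeff_f mult.commute)
  qed (use A in auto)
  ultimately show ?thesis by blast
qed

section \<open>Minimal polynomials of Hermitian matrices\<close>

text \<open>This is the minimal polynomial up to a nonzero constant factor.\<close>

definition minimal_annihilator :: "'a :: comm_ring_1 mat \<Rightarrow> 'a poly \<Rightarrow> bool" where
  "minimal_annihilator A f \<longleftrightarrow> f \<noteq> 0 \<and> mat_poly A f = 0\<^sub>m (dim_row A) (dim_row A) \<and>
     (\<forall>g. g \<noteq> 0 \<longrightarrow> mat_poly A g = 0\<^sub>m (dim_row A) (dim_row A) \<longrightarrow> degree f \<le> degree g)"

lemma minimal_annihilator_exists:
  fixes A :: "'a :: field mat"
  assumes "A \<in> carrier_mat n n"
  shows "\<exists>f. minimal_annihilator A f"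
proof -
  obtain f where "f \<noteq> 0 \<and> mat_poly A f = 0\<^sub>m n n"
    using annihilating_polynomial_exists[OF assms] by blast
  from ex_has_least_nat[of "\<lambda>f. f \<noteq> 0 \<and> mat_poly A f = 0\<^sub>m n n", OF this, of degree]
  show ?thesis using assms unfolding minimal_annihilator_def by auto
qed

lemma minimal_annihilator_low_degree:
  assumes "minimal_annihilator A f" "A \<in> carrier_mat n n" "mat_poly A g = 0\<^sub>m n n"
    and "degree g < degree f"
  shows "g = 0"
  using assms unfolding minimal_annihilator_def by (metis carrier_matD(1) not_less)

text \<open>Dividing out the root leaves a polynomial of lower degree, whose value at the matrix is
  therefore nonzero; its nonzero columns are eigenvectors.\<close>

lemma root_minimal_annihilator_imp_eigenvalue:
  fixes A :: "'a :: field mat"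
  assumes A: "A \<in> carrier_mat n n" and f: "minimal_annihilator A f" and z: "poly f z = 0"
  shows "eigenvalue A z"
proof -
  from f A have f0: "f \<noteq> 0" "mat_poly A f = 0\<^sub>m n n" by (auto simp: minimal_annihilator_def)
  from z obtain r where r: "f = [:-z, 1:] * r" unfolding poly_eq_0_iff_dvd by blast
  with f0 have "r \<noteq> 0" by auto
  then have "degree r < degree f" unfolding r by (subst degree_mult_eq) auto
  with minimal_annihilator_low_degree[OF f A] \<open>r \<noteq> 0\<close> have "mat_poly A r \<noteq> 0\<^sub>m n n" by blast
  then obtain i j where ij: "i < n" "j < n" "mat_poly A r $$ (i, j) \<noteq> 0"
    using mat_poly_carrier[OF A, of r] by (metis eq_matI index_zero_mat carrier_matD)
  define v where "v = col (mat_poly A r) j"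
  have "v $ i \<noteq> 0" using ij A by (simp add: v_def)
  then have "v \<noteq> 0\<^sub>v n" using ij by auto
  have "[:0, 1:] * r = f + Polynomial.smult z r" by (simp add: r)
  then have "mat_poly A ([:0, 1:] * r) = mat_poly A (f + Polynomial.smult z r)" by simp
  then have "A * mat_poly A r = z \<cdot>\<^sub>m mat_poly A r"
    using A f0(2)
    by (simp only: mat_poly_mult[OF A] mat_poly_add[OF A] mat_poly_smult[OF A] mat_poly_X[OF A])
      (simp add: left_add_zero_mat[of _ n n])
  then have "col (A * mat_poly A r) j = col (z \<cdot>\<^sub>m mat_poly A r) j" by simp
  then have "A *\<^sub>v v = z \<cdot>\<^sub>v v"
    using ij A by (simp add: v_def col_mult2[OF A mat_poly_carrier[OF A]])
  moreover have "v \<in> carrier_vec n"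
    unfolding v_def by (rule carrier_vecI) (simp add: mat_poly_dim[OF A])
  ultimately show ?thesis
    using \<open>v \<noteq> 0\<^sub>v n\<close> A unfolding eigenvalue_def eigenvector_def by auto
qed

lemma comm_ring_hom_cnj: "comm_ring_hom cnj"
  by unfold_locales auto

text \<open>If \<open>R = p(A)\<close>, then \<open>map_poly cnj p\<close> at \<open>A\<close> is the adjoint of \<open>R\<close>, and the diagonal entries of
  the product are the squared norms of the columns of \<open>R\<close>.\<close>

lemma mat_poly_eq_0_of_norm:
  assumes A: "A \<in> carrier_mat n n"
    and herm: "\<And>i j. i < n \<Longrightarrow> j < n \<Longrightarrow> cnj (A $$ (j, i)) = A $$ (i, j)"
    and 0: "mat_poly A (map_poly cnj p * p) = 0\<^sub>m n n"
  shows "mat_poly A p = 0\<^sub>m n n"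
proof (intro eq_matI)
  fix i j assume "i < dim_row (0\<^sub>m n n)" "j < dim_col (0\<^sub>m n n)"
  then have ij: "i < n" "j < n" by auto
  let ?R = "mat_poly A p"
  have "0 = mat_poly A (map_poly cnj p * p) $$ (j, j)" using 0 ij by simp
  also have "\<dots> = (\<Sum>l\<in>{0..<n}. mat_poly A (map_poly cnj p) $$ (j, l) * ?R $$ (l, j))"
    using ij A by (simp add: mat_poly_mult[OF A] scalar_prod_def)
  also have "\<dots> = (\<Sum>l\<in>{0..<n}. of_real ((cmod (?R $$ (l, j)))\<^sup>2))"
  proof (rule sum.cong[OF refl])
    fix l assume "l \<in> {0..<n}"
    then have "mat_poly A (map_poly cnj p) $$ (j, l) = cnj (?R $$ (l, j))"
      using mat_poly_twisted_transpose[OF A comm_ring_hom_cnj herm] ij by simp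
    then show "mat_poly A (map_poly cnj p) $$ (j, l) * ?R $$ (l, j) = of_real ((cmod (?R $$ (l, j)))\<^sup>2)"
      by (metis complex_norm_square mult.commute)
  qed
  finally have "(\<Sum>l\<in>{0..<n}. (cmod (?R $$ (l, j)))\<^sup>2) = 0"
    by (metis of_real_sum of_real_eq_0_iff)
  then have "?R $$ (i, j) = 0" using ij by (simp add: sum_nonneg_eq_0_iff)
  then show "?R $$ (i, j) = 0\<^sub>m n n $$ (i, j)" using ij by simp
qed (use A in auto)

text \<open>Hermitian matrices are diagonalisable, which amounts to the following. Let
  \<open>f = (X - z)\<^sup>2 r\<close> and write \<open>p\<^sup>*\<close> for conjugated coefficients. For \<open>h = (X - z) r\<close> and
  \<open>u = (X - cnj z) h\<close>, the product \<open>u\<^sup>* u\<close> is a multiple of \<open>f\<close>, so that \<open>u(A) = 0\<close>; and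
  \<open>h\<^sup>* h = r\<^sup>* u\<close>, so that \<open>h(A) = 0\<close>, although \<open>h\<close> has lower degree than \<open>f\<close>. This is the
  argument that a normal matrix has no generalised eigenvectors of higher rank.\<close>

lemma minimal_annihilator_rsquarefree:
  assumes A: "A \<in> carrier_mat n n"
    and herm: "\<And>i j. i < n \<Longrightarrow> j < n \<Longrightarrow> cnj (A $$ (j, i)) = A $$ (i, j)"
    and f: "minimal_annihilator A f"
  shows "rsquarefree f"
proof -
  from f A have f0: "f \<noteq> 0" "mat_poly A f = 0\<^sub>m n n" by (auto simp: minimal_annihilator_def)
  interpret cnj: comm_ring_hom cnj by (rule comm_ring_hom_cnj)
  interpret cnj_poly: map_poly_comm_ring_hom cnj ..
  have "order z f < 2" for z
  proof (rule ccontr)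
    assume "\<not> order z f < 2"
    then have "[:-z, 1:] ^ 2 dvd f" by (subst order_divides) simp
    then obtain r where r: "f = [:-z, 1:] ^ 2 * r" by blast
    define h u where "h = [:-z, 1:] * r" and "u = [:-cnj z, 1:] * h"
    have "map_poly cnj u = [:-z, 1:] * ([:-cnj z, 1:] * map_poly cnj r)"
      unfolding u_def h_def cnj_poly.hom_mult by simp
    then have "map_poly cnj u * u = f * ([:-cnj z, 1:] ^ 2 * map_poly cnj r)"
      unfolding u_def h_def r power2_eq_square by (simp only: mult_ac)
    then have "mat_poly A u = 0\<^sub>m n n"
      using mat_poly_eq_0_dvd[OF A f0(2)] mat_poly_eq_0_of_norm[OF A herm] by (metis dvd_triv_left)
    moreover have "map_poly cnj h = [:-cnj z, 1:] * map_poly cnj r"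
      unfolding h_def cnj_poly.hom_mult by simp
    then have "map_poly cnj h * h = u * map_poly cnj r"
      unfolding u_def by (simp only: mult_ac)
    ultimately have "mat_poly A h = 0\<^sub>m n n"
      using mat_poly_eq_0_dvd[OF A] mat_poly_eq_0_of_norm[OF A herm] by (metis dvd_triv_left)
    moreover have fh: "f = [:-z, 1:] * h" by (simp only: r h_def power2_eq_square mult.assoc)
    with f0(1) have "h \<noteq> 0" by auto
    then have "degree h < degree f" unfolding fh by (subst degree_mult_eq) auto
    ultimately show False
      using minimal_annihilator_low_degree[OF f A] \<open>h \<noteq> 0\<close> by blast
  qed
  then have "order z f = 0 \<or> order z f = 1" for z by (metis less_2_cases One_nat_def)
  with f0(1) show ?thesis by (simp add: rsquarefree_def)
qed

lemma degree_minimal_annihilator_le_spectrum: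
  assumes A: "A \<in> carrier_mat n n"
    and herm: "\<And>i j. i < n \<Longrightarrow> j < n \<Longrightarrow> cnj (A $$ (j, i)) = A $$ (i, j)"
    and f: "minimal_annihilator A f"
  shows "degree f \<le> card (spectrum A)"
proof -
  have "degree f = card {z. poly f z = 0}"
    using card_roots_rsquarefree[OF minimal_annihilator_rsquarefree[OF A herm f]] by simp
  also have "\<dots> \<le> card (spectrum A)"
    using root_minimal_annihilator_imp_eigenvalue[OF A f] card_finite_spectrum(1)[OF A]
    by (intro card_mono) (auto simp: spectrum_def)
  finally show ?thesis .
qed

section \<open>The resolvent as a point of a moment curve\<close>

lemma binary_form_Suc:
  "binary_form (Suc m) a s t = s * binary_form m a s t + t ^ Suc m * a (Suc m)"
proof -
  have "(\<Sum>k\<le>m. s ^ (Suc m - k) * t ^ k * a k) = s * binary_form m a s t"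
    unfolding binary_form_def sum_distrib_left
    by (intro sum.cong) (auto simp: Suc_diff_le mult_ac)
  then show ?thesis by (simp add: binary_form_def)
qed

text \<open>The polynomials \<open>r k\<close> are the partial results of the Horner scheme for the polynomial
  \<open>f = r (Suc m)\<close>, whose coefficients, starting with the leading one, are \<open>c 0, c 1, \<dots>\<close>. As in
  synthetic division, they are the coefficients, with respect to \<open>x\<close>, of the quotient
  \<open>(f(x) - f(X)) / (x - X)\<close>; here this is homogenised with \<open>x = s / t\<close>.\<close>

lemma horner_quotient:
  fixes c :: "nat \<Rightarrow> complex"
  assumes r0: "r 0 = [:c 0:]" and r_Suc: "\<And>k. k \<le> m \<Longrightarrow> r (Suc k) = pCons (c (Suc k)) (r k)"
  shows "[:s, - t:] * (\<Sum>k\<le>m. Polynomial.smult (s ^ (m - k) * t ^ k) (r k)) =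
    [:binary_form (Suc m) c s t:] - Polynomial.smult (t ^ Suc m) (r (Suc m))"
  using r_Suc
proof (induction m)
  case 0
  then show ?case by (simp add: r0 binary_form_def)
next
  case (Suc m)
  let ?G = "\<lambda>m. \<Sum>k\<le>m. Polynomial.smult (s ^ (m - k) * t ^ k) (r k)"
  have X: "pCons 0 (r (Suc m)) = r (Suc (Suc m)) - [:c (Suc (Suc m)):]"
    using Suc.prems[of "Suc m"] by simp
  have "Polynomial.smult s (?G m) = (\<Sum>k\<le>m. Polynomial.smult (s ^ (Suc m - k) * t ^ k) (r k))"
    unfolding smult_sum2 by (intro sum.cong) (auto simp: Suc_diff_le mult_ac)
  then have "?G (Suc m) = Polynomial.smult s (?G m) + Polynomial.smult (t ^ Suc m) (r (Suc m))"
    by simp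
  then have "[:s, - t:] * ?G (Suc m) = Polynomial.smult s ([:s, - t:] * ?G m) +
      Polynomial.smult (t ^ Suc m) ([:s, - t:] * r (Suc m))"
    by (simp only: distrib_left mult_smult_right)
  also have "[:s, - t:] * ?G m =
      [:binary_form (Suc m) c s t:] - Polynomial.smult (t ^ Suc m) (r (Suc m))"
    using Suc by simp
  also have "[:s, - t:] * r (Suc m) =
      Polynomial.smult s (r (Suc m)) - Polynomial.smult t (r (Suc (Suc m)) - [:c (Suc (Suc m)):])"
    unfolding X[symmetric] by simp
  finally show ?case
    by (simp add: binary_form_Suc[of "Suc m"] smult_diff_right mult_ac)
qed

lemma sum_smult_eq_0_degree:
  fixes r :: "nat \<Rightarrow> complex poly"
  assumes "\<And>k. k \<le> e \<Longrightarrow> r k \<noteq> 0 \<and> degree (r k) = k"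
    and "(\<Sum>k\<le>e. Polynomial.smult (c k) (r k)) = 0" and "k \<le> e"
  shows "c k = 0"
  using assms
proof (induction e arbitrary: k)
  case 0
  then show ?case by simp
next
  case (Suc e)
  have "coeff (\<Sum>k\<le>e. Polynomial.smult (c k) (r k)) (Suc e) = 0"
    using Suc.prems(1) by (auto simp: coeff_sum coeff_eq_0)
  then have "c (Suc e) * coeff (r (Suc e)) (Suc e) = 0"
    using arg_cong[OF Suc.prems(2), of "\<lambda>p. coeff p (Suc e)"] by simp
  moreover have "coeff (r (Suc e)) (Suc e) \<noteq> 0"
    using Suc.prems(1)[of "Suc e"] leading_coeff_0_iff[of "r (Suc e)"] by simp
  ultimately have "c (Suc e) = 0" by simp
  with Suc.IH[of k] Suc.prems show ?case by (cases "k = Suc e") auto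
qed

section \<open>The reciprocal variety\<close>

lemma adjacency_mat_carrier: "adjacency_mat n E \<in> carrier_mat n n"
  by (simp add: adjacency_mat_def)

lemma adjacency_mat_sym:
  assumes "i < n" "j < n"
  shows "adjacency_mat n E $$ (j, i) = adjacency_mat n E $$ (i, j)"
    and "cnj (adjacency_mat n E $$ (j, i)) = adjacency_mat n E $$ (i, j)"
  using assms by (auto simp: adjacency_mat_def insert_commute)

lemma conc_mat_eq_mat_poly: "conc_mat n E a b = mat_poly (adjacency_mat n E) [:a, b:]"
  by (simp add: conc_mat_def mat_poly_linear[OF adjacency_mat_carrier])

lemma finite_upper_idx: "finite (upper_idx n)"
  by (rule finite_subset[of _ "{..n} \<times> {..n}"]) (auto simp: upper_idx_def)

lemma upper_entries_in_coord_space: "upper_entries n B \<in> coord_space (upper_idx n)"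
  by (auto simp: coord_space_def upper_entries_def)

lemma upper_entries_sum:
  "(\<Sum>k\<in>K. c k * upper_entries n (mat_poly (adjacency_mat n E) (r k)) i) =
    upper_entries n (mat_poly (adjacency_mat n E) (\<Sum>k\<in>K. Polynomial.smult (c k) (r k))) i"
proof (cases i)
  case (Pair a b)
  show ?thesis
  proof (cases "i \<in> upper_idx n")
    case True
    then have "a - 1 < n" "b - 1 < n" unfolding Pair upper_idx_def by auto
    with True show ?thesis
      unfolding Pair by (simp add: upper_entries_def mat_poly_sum_index[OF adjacency_mat_carrier])
  qed (simp add: Pair upper_entries_def)
qed

lemma mat_poly_eq_0_of_upper_entries:
  assumes "\<And>i. upper_entries n (mat_poly (adjacency_mat n E) p) i = 0"
  shows "mat_poly (adjacency_mat n E) p = 0\<^sub>m n n"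
proof (intro eq_matI)
  let ?B = "mat_poly (adjacency_mat n E) p"
  have upper: "?B $$ (i, j) = 0" if "i \<le> j" "j < n" for i j
    using assms[of "(Suc i, Suc j)"] that by (simp add: upper_entries_def upper_idx_def)
  have sym: "?B $$ (i, j) = ?B $$ (j, i)" if "i < n" "j < n" for i j
  proof -
    have "comm_ring_hom (\<lambda>x :: complex. x)" by unfold_locales auto
    from mat_poly_twisted_transpose[OF adjacency_mat_carrier this adjacency_mat_sym(1) that]
    show ?thesis by (simp add: map_poly_idI)
  qed
  fix i j assume "i < dim_row (0\<^sub>m n n)" "j < dim_col (0\<^sub>m n n)"
  then have ij: "i < n" "j < n" by auto
  then have "?B $$ (i, j) = 0"
    using upper[of i j] upper[of j i] sym[of i j] by (cases "i \<le> j") auto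
  then show "?B $$ (i, j) = 0\<^sub>m n n $$ (i, j)" using ij by simp
qed (simp_all add: mat_poly_dim[OF adjacency_mat_carrier])

text \<open>The adjacency matrix of a graph with an edge is not a multiple of the identity: its diagonal
  vanishes, whereas it is not zero.\<close>

lemma degree_minimal_annihilator_adjacency:
  assumes graph: "simple_graph n E" and E: "E \<noteq> {}"
    and f: "minimal_annihilator (adjacency_mat n E) f"
  shows "degree f > 1"
proof (rule ccontr)
  let ?A = "adjacency_mat n E"
  note A = adjacency_mat_carrier[of n E]
  from E obtain x where x: "x \<in> E" by blast
  with graph have "x \<subseteq> {1..n}" "card x = 2" unfolding simple_graph_def by auto
  then obtain u v where uv: "x = {u, v}" "u \<noteq> v" "1 \<le> u" "u \<le> n" "1 \<le> v" "v \<le> n"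
    by (auto simp: card_2_iff)
  define i j where "i = u - 1" and "j = v - 1"
  have ij: "i < n" "j < n" "i \<noteq> j" "{Suc i, Suc j} \<in> E"
    using uv x by (auto simp: i_def j_def)
  have "{Suc i} \<notin> E" using graph unfolding simple_graph_def by force
  assume "\<not> degree f > 1"
  then have f_eq: "f = [:coeff f 0, coeff f 1:]"
    by (intro poly_eqI) (auto simp: coeff_pCons coeff_eq_0 split: nat.splits)
  have f0: "f \<noteq> 0" and Af: "mat_poly ?A f = 0\<^sub>m n n"
    using f A unfolding minimal_annihilator_def by auto
  have "coeff f 0 \<cdot>\<^sub>m 1\<^sub>m n + coeff f 1 \<cdot>\<^sub>m ?A = 0\<^sub>m n n"
    unfolding mat_poly_linear[OF A, symmetric] f_eq[symmetric] by (rule Af)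
  then have entry: "(coeff f 0 \<cdot>\<^sub>m 1\<^sub>m n + coeff f 1 \<cdot>\<^sub>m ?A) $$ (k, l) = 0" if "k < n" "l < n" for k l
    using that by simp
  have "coeff f 0 = 0"
    using entry[of i i] ij A \<open>{Suc i} \<notin> E\<close> by (simp add: adjacency_mat_def)
  moreover have "coeff f 1 = 0"
    using entry[of i j] ij A by (simp add: adjacency_mat_def)
  ultimately show False using f_eq f0 by simp
qed

text \<open>Write \<open>K = s Id - t A\<close>, that is, \<open>s = \<theta>1\<close> and \<open>t = - \<theta>2\<close>. The value \<open>Q\<close> at \<open>A\<close> of the Horner
  quotient of \<open>f\<close> satisfies \<open>K Q = P(s, t) Id\<close>, where \<open>P\<close> is the homogenised \<open>f\<close>. If \<open>K\<close> is
  invertible, then \<open>P(s, t) \<noteq> 0\<close>, because otherwise \<open>Q = 0\<close>, which by the independence of the \<open>w k\<close>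
  happens only for \<open>s = t = 0\<close>. As \<open>K\<close> can be rescaled, every nonzero multiple of \<open>Q\<close> occurs as
  an inverse.\<close>

lemma reciprocal_image_moment_curve:
  fixes n E
  defines "A \<equiv> adjacency_mat n E"
  assumes n: "n > 0" and f: "minimal_annihilator A f" and deg: "degree f = Suc e"
  defines "w \<equiv> \<lambda>k. upper_entries n (mat_poly A (poly_shift (Suc e - k) f))"
    and "P \<equiv> \<lambda>k. coeff f (Suc e - k)"
  shows "independent_family e w"
    and "reciprocal_image n E =
      {\<lambda>i. c * moment_curve e w s t i | c s t. c \<noteq> 0 \<and> binary_form (Suc e) P s t \<noteq> 0}"
proof -
  have A: "A \<in> carrier_mat n n" unfolding A_def by (rule adjacency_mat_carrier)
  have Af: "mat_poly A f = 0\<^sub>m n n" using f A unfolding minimal_annihilator_def by auto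
  define r where "r k = poly_shift (Suc e - k) f" for k
  define g where "g c = (\<Sum>k\<le>e. Polynomial.smult (c k) (r k))" for c
  define Q where "Q s t = mat_poly A (g (\<lambda>k. s ^ (e - k) * t ^ k))" for s t
  have degree_r: "r k \<noteq> 0 \<and> degree (r k) = k" if "k \<le> e" for k
  proof -
    have "coeff (r k) k \<noteq> 0"
      using that deg leading_coeff_0_iff[of f] by (auto simp: r_def coeff_poly_shift)
    moreover have "degree (r k) \<le> k"
      using deg that by (intro degree_le) (auto simp: r_def coeff_poly_shift coeff_eq_0)
    ultimately show ?thesis by (metis coeff_0 le_antisym le_degree)
  qed
  have g_eq_0: "c k = 0" if "mat_poly A (g c) = 0\<^sub>m n n" "k \<le> e" for c k
  proof -
    have "degree (g c) \<le> e"
      unfolding g_def using degree_r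
      by (intro degree_sum_le) (auto intro: order_trans[OF degree_smult_le])
    then have "g c = 0"
      using minimal_annihilator_low_degree[OF f A that(1)] deg by simp
    then show ?thesis
      unfolding g_def using sum_smult_eq_0_degree[OF degree_r] that(2) by blast
  qed
  have sum_w: "(\<Sum>k\<le>e. c k * w k i) = upper_entries n (mat_poly A (g c)) i" for c i
    unfolding w_def g_def r_def A_def by (rule upper_entries_sum)
  show "independent_family e w"
    unfolding independent_family_def sum_w
    using mat_poly_eq_0_of_upper_entries[of n E] g_eq_0 unfolding A_def by blast
  have curve: "moment_curve e w s t = upper_entries n (Q s t)" for s t
    unfolding moment_curve_def binary_form_def Q_def sum_w[symmetric] ..
  have Q: "Q s t \<in> carrier_mat n n" for s t unfolding Q_def using A by simp
  have product: "conc_mat n E s (- t) * Q s t = binary_form (Suc e) P s t \<cdot>\<^sub>m 1\<^sub>m n" for s t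
  proof -
    have "[:s, - t:] * g (\<lambda>k. s ^ (e - k) * t ^ k) =
        [:binary_form (Suc e) P s t:] - Polynomial.smult (t ^ Suc e) (r (Suc e))"
      unfolding g_def
    proof (rule horner_quotient)
      show "r 0 = [:P 0:]"
        using deg by (intro poly_eqI)
          (auto simp: r_def P_def coeff_poly_shift coeff_pCons coeff_eq_0 split: nat.splits)
      show "r (Suc k) = pCons (P (Suc k)) (r k)" if "k \<le> e" for k
        using that by (intro poly_eqI)
          (auto simp: r_def P_def coeff_poly_shift coeff_pCons Suc_diff_le split: nat.splits)
    qed
    also have "r (Suc e) = f" by (simp add: r_def)
    finally have "[:s, - t:] * g (\<lambda>k. s ^ (e - k) * t ^ k) =
        [:binary_form (Suc e) P s t:] + Polynomial.smult (- (t ^ Suc e)) f" by simp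
    then have "mat_poly A [:s, - t:] * Q s t =
        mat_poly A [:binary_form (Suc e) P s t:] + - (t ^ Suc e) \<cdot>\<^sub>m mat_poly A f"
      unfolding Q_def mat_poly_mult[OF A, symmetric]
      by (simp only: mat_poly_add[OF A] mat_poly_smult[OF A])
    then show ?thesis
      unfolding conc_mat_eq_mat_poly A_def[symmetric] Af mat_poly_const[OF A] by simp
  qed
  have K: "conc_mat n E a b \<in> carrier_mat n n" for a b
    unfolding conc_mat_eq_mat_poly using mat_poly_carrier[OF adjacency_mat_carrier] .
  have scale_entries: "upper_entries n (c \<cdot>\<^sub>m B) = (\<lambda>i. c * upper_entries n B i)"
    if "B \<in> carrier_mat n n" for c B
    using that by (auto simp: upper_entries_def upper_idx_def fun_eq_iff)
  show "reciprocal_image n E =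
      {\<lambda>i. c * moment_curve e w s t i | c s t. c \<noteq> 0 \<and> binary_form (Suc e) P s t \<noteq> 0}"
    (is "_ = ?S")
  proof
    show "reciprocal_image n E \<subseteq> ?S"
    proof
      fix y assume "y \<in> reciprocal_image n E"
      then obtain B a b where y: "y = upper_entries n B" and B: "B \<in> carrier_mat n n"
        and inv: "inverts_mat (conc_mat n E a b) B" "inverts_mat B (conc_mat n E a b)"
        unfolding reciprocal_image_def by blast
      let ?p = "binary_form (Suc e) P a (- b)"
      have BK: "B * conc_mat n E a b = 1\<^sub>m n" and KB: "conc_mat n E a b * B = 1\<^sub>m n"
        using inv B K[of a b] by (auto simp: inverts_mat_def)
      have "Q a (- b) = (B * conc_mat n E a b) * Q a (- b)"
        unfolding BK by (rule left_mult_one_mat[OF Q, symmetric])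
      also have "\<dots> = B * (?p \<cdot>\<^sub>m 1\<^sub>m n)"
        using product[of a "- b"] by (simp add: assoc_mult_mat[OF B K Q])
      also have "\<dots> = ?p \<cdot>\<^sub>m B"
        using B by (simp add: mult_smult_distrib[OF B one_carrier_mat])
      finally have QB: "Q a (- b) = ?p \<cdot>\<^sub>m B" .
      have "?p \<noteq> 0"
      proof
        assume "?p = 0"
        then have "Q a (- b) = 0\<^sub>m n n" using B by (subst QB) (intro eq_matI, auto)
        then have "a ^ (e - k) * (- b) ^ k = 0" if "k \<le> e" for k
          unfolding Q_def using g_eq_0 that by blast
        from this[of 0] this[of e] have "a = 0" "b = 0" by auto
        then have "conc_mat n E a b = 0\<^sub>m n n"
          by (simp add: conc_mat_eq_mat_poly mat_poly_0[OF adjacency_mat_carrier])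
        with KB B have "0\<^sub>m n n = (1\<^sub>m n :: complex mat)" by simp
        from arg_cong[OF this, of "\<lambda>M. M $$ (0, 0)"] n show False by simp
      qed
      then have "B = (1 / ?p) \<cdot>\<^sub>m Q a (- b)"
        unfolding QB using B by (intro eq_matI) auto
      then have "y = (\<lambda>i. (1 / ?p) * moment_curve e w a (- b) i)"
        unfolding y curve using scale_entries[OF Q] by simp
      with \<open>?p \<noteq> 0\<close> show "y \<in> ?S"
        by (intro CollectI exI[of _ "1 / ?p"] exI[of _ a] exI[of _ "- b"]) simp
    qed
    show "?S \<subseteq> reciprocal_image n E"
    proof
      fix y assume "y \<in> ?S"
      then obtain c s t where y: "y = (\<lambda>i. c * moment_curve e w s t i)"
        and c: "c \<noteq> 0" "binary_form (Suc e) P s t \<noteq> 0" by blast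
      \<comment> \<open>Scaling the concentration matrix by \<open>d\<close> turns its inverse \<open>Q / P(s, t)\<close> into \<open>c Q\<close>.\<close>
      define d where "d = 1 / (c * binary_form (Suc e) P s t)"
      have "conc_mat n E (d * s) (d * (- t)) = d \<cdot>\<^sub>m conc_mat n E s (- t)"
        unfolding conc_mat_eq_mat_poly
        using mat_poly_smult[OF adjacency_mat_carrier, of n E d "[:s, - t:]"] by simp
      then have "conc_mat n E (d * s) (d * (- t)) * (c \<cdot>\<^sub>m Q s t) =
          (d * c) \<cdot>\<^sub>m (conc_mat n E s (- t) * Q s t)"
        using K[of s "- t"] Q[of s t]
        by (simp add: mult_smult_assoc_mat[of _ n n _ n] mult_smult_distrib[of _ n n _ n])
          (intro eq_matI, auto)
      also have "\<dots> = 1\<^sub>m n"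
        unfolding product using c by (intro eq_matI) (auto simp: d_def)
      finally have KB: "conc_mat n E (d * s) (d * (- t)) * (c \<cdot>\<^sub>m Q s t) = 1\<^sub>m n" .
      have B: "c \<cdot>\<^sub>m Q s t \<in> carrier_mat n n" using Q by simp
      have "(c \<cdot>\<^sub>m Q s t) * conc_mat n E (d * s) (d * (- t)) = 1\<^sub>m n"
        by (rule mat_mult_left_right_inverse[OF K B KB])
      moreover have "y = upper_entries n (c \<cdot>\<^sub>m Q s t)"
        unfolding y curve using scale_entries[OF Q] by simp
      ultimately show "y \<in> reciprocal_image n E"
        using KB B K[of "d * s" "d * (- t)"] unfolding reciprocal_image_def inverts_mat_def
        by (intro CollectI exI[of _ "c \<cdot>\<^sub>m Q s t"] exI[of _ "d * s"] exI[of _ "d * (- t)"]) auto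
    qed
  qed
qed

theorem theorem6p6:
  fixes n :: nat and E :: "nat set set"
  assumes "simple_graph n E" and "E \<noteq> {}"
  shows "\<exists>C e. rational_normal_curve (upper_idx n) e C \<and>
           reciprocal_variety n E = affine_cone C \<and>
           has_curve_degree (upper_idx n) C e \<and>
           e \<le> card (spectrum (adjacency_mat n E))"
proof -
  let ?A = "adjacency_mat n E"
  obtain f where f: "minimal_annihilator ?A f"
    using minimal_annihilator_exists[OF adjacency_mat_carrier] by blast
  define e where "e = degree f - 1"
  have deg: "degree f = Suc e" and e: "e > 0"
    using degree_minimal_annihilator_adjacency[OF assms f] by (auto simp: e_def)
  have n: "n > 0"
  proof (rule ccontr)
    assume "\<not> n > 0"
    with assms show False by (auto simp: simple_graph_def)
  qed
  define w where "w k = upper_entries n (mat_poly ?A (poly_shift (Suc e - k) f))" for k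
  have w: "\<forall>k\<le>e. w k \<in> coord_space (upper_idx n)"
    by (simp add: w_def upper_entries_in_coord_space)
  note image = reciprocal_image_moment_curve[OF n f deg, folded w_def]
  have ind: "independent_family e w" by (rule image(1))
  have "coeff f (Suc e - 0) \<noteq> 0"
    using deg leading_coeff_0_iff[of f] by auto
  then have "reciprocal_variety n E = affine_cone (moment_lines e w)"
    unfolding reciprocal_variety_def image(2)
    by (intro zariski_closure_dense_part_of_cone finite_upper_idx w ind e)
  moreover have "rational_normal_curve (upper_idx n) e (moment_lines e w)"
    unfolding rational_normal_curve_iff using e w ind by blast
  moreover have "has_curve_degree (upper_idx n) (moment_lines e w) e"
    by (rule has_curve_degree_moment_lines[OF finite_upper_idx w ind e])
  moreover have "e \<le> card (spectrum ?A)"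
    using degree_minimal_annihilator_le_spectrum[OF adjacency_mat_carrier adjacency_mat_sym(2) f] deg
    by simp
  ultimately show ?thesis by blast
qed

end
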